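(* Let $d\geq 1$ and let $x\in\mathbb{R}^d$ be drawn at random with respect to the spherical Gaussian distribution with zero mean and unit variance. Then $$\mathrm{P}\bigl[\,\bigl|\|x\|-\sqrt{d}\,\bigr|\geq \epsilon\,\bigr]\leq 2\exp(-c\,\epsilon^2)$$ holds for every $0\leq\epsilon\leq\sqrt{d}$, where $c=1/16$.
   Context: The spherical Gaussian distribution on $\mathbb{R}^d$ with zero mean and unit variance has density $(2\pi)^{-d/2}\exp(-\|x\|^2/2)$ with respect to Lebesgue measure. $\|\cdot\|$ is the Euclidean norm. *)

theory Defs
  imports "HOL-Probability.Probability"
begin

definition spherical_gaussian_density :: "real ^ 'n \<Rightarrow> real" where
  "spherical_gaussian_density x =
     (2 * pi) powr (- (real CARD('n) / 2)) * exp (- (norm x)\<^sup>2 / 2)"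

end

theory Submission
  imports Defs
begin

text \<open>
  Both tails follow from one estimate. Put \<open>d = CARD('n)\<close>, let \<open>s > 0\<close> be a radius, and
  compare the standard Gaussian with the Gaussian of standard deviation \<open>\<sigma> = s / sqrt d\<close>,
  whose mass concentrates around radius \<open>s\<close>. At radius \<open>s\<close> the ratio of the two
  exponentials is \<open>exp (- (s\<^sup>2 - d) / 2)\<close>. Moving away from the sphere of radius \<open>s\<close> on the
  side opposite to the sphere of radius \<open>sqrt d\<close>, the ratio only decreases. Integrating
  over that side, and using that the standard density has total mass 1, so that its
  dilation by \<open>\<sigma>\<close> has mass \<open>\<sigma> ^ d\<close>, bounds the probability of that side by
  \<open>exp (- (s\<^sup>2 - d) / 2) * \<sigma> ^ d\<close>. Since \<open>\<sigma> \<le> exp (\<sigma> - 1)\<close>, this is at most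
  \<open>exp (- (s - sqrt d)\<^sup>2 / 2)\<close> (lemma \<open>gaussian_beyond_radius\<close>).

  The theorem is the sum of the cases \<open>s = sqrt d + \<epsilon>\<close> and \<open>s = sqrt d - \<epsilon>\<close>, which even
  gives the exponent \<open>- \<epsilon>\<^sup>2 / 2\<close>. This is the Chernoff bound for \<open>(norm x)\<^sup>2\<close> with the optimal
  exponential tilt; as the tilted density is a rescaling of the original one, no Gaussian
  integral has to be evaluated.
\<close>

lemma nn_integral_lborel_dilate:
  fixes f :: "'b::euclidean_space \<Rightarrow> ennreal"
  assumes [measurable]: "f \<in> borel_measurable borel" and "\<sigma> > 0"
  shows "(\<integral>\<^sup>+x. f (x /\<^sub>R \<sigma>) \<partial>lborel) = ennreal (\<sigma> ^ DIM('b)) * (\<integral>\<^sup>+x. f x \<partial>lborel)"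
proof -
  have "(\<integral>\<^sup>+x. f (x /\<^sub>R \<sigma>) \<partial>lborel)
      = (\<integral>\<^sup>+x. f (x /\<^sub>R \<sigma>) \<partial>density (distr lborel borel (\<lambda>x. 0 + \<sigma> *\<^sub>R x)) (\<lambda>_. \<bar>\<sigma>\<bar> ^ DIM('b)))"
    using lborel_affine[of \<sigma> "0::'b"] \<open>\<sigma> > 0\<close> by simp
  also have "\<dots> = ennreal (\<sigma> ^ DIM('b)) * (\<integral>\<^sup>+x. f x \<partial>lborel)"
    using \<open>\<sigma> > 0\<close> by (simp add: nn_integral_density nn_integral_distr nn_integral_cmult)
  finally show ?thesis .
qed

lemma borel_measurable_spherical_gaussian_density [measurable]:
  "spherical_gaussian_density \<in> borel_measurable borel"
  unfolding spherical_gaussian_density_def by measurable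

text \<open>
  The difference of the two exponents is
  \<open>- ((norm x)\<^sup>2 - s\<^sup>2) * (s\<^sup>2 - d) / (2 * s\<^sup>2)\<close> with \<open>d = CARD('n)\<close>, so the sign hypothesis says exactly that
  the comparison holds at \<open>x\<close>.
\<close>
lemma spherical_gaussian_density_le_dilated:
  fixes x :: "real ^ 'n"
  assumes "s > 0" and "0 \<le> ((norm x)\<^sup>2 - s\<^sup>2) * (s\<^sup>2 - real CARD('n))"
  shows "spherical_gaussian_density x
    \<le> exp (- (s\<^sup>2 - real CARD('n)) / 2)
        * spherical_gaussian_density (x /\<^sub>R (s / sqrt (real CARD('n))))"
proof -
  define d where "d = real CARD('n)"
  have d: "d > 0" by (simp add: d_def)
  have "(norm (x /\<^sub>R (s / sqrt d)))\<^sup>2 = (norm x)\<^sup>2 * d / s\<^sup>2"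
    using assms(1) d by (simp add: power_mult_distrib power_divide divide_inverse power_inverse)
  moreover have "- (norm x)\<^sup>2 / 2 \<le> - (s\<^sup>2 - d) / 2 + - ((norm x)\<^sup>2 * d / s\<^sup>2) / 2"
    using assms d unfolding d_def[symmetric] by (simp add: field_simps)
  ultimately have "exp (- (norm x)\<^sup>2 / 2)
      \<le> exp (- (s\<^sup>2 - d) / 2) * exp (- (norm (x /\<^sub>R (s / sqrt d)))\<^sup>2 / 2)"
    by (simp add: exp_add[symmetric])
  then have "(2 * pi) powr - (d / 2) * exp (- (norm x)\<^sup>2 / 2)
      \<le> (2 * pi) powr - (d / 2)
          * (exp (- (s\<^sup>2 - d) / 2) * exp (- (norm (x /\<^sub>R (s / sqrt d)))\<^sup>2 / 2))"
    by (intro mult_left_mono) auto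
  then show ?thesis
    unfolding spherical_gaussian_density_def d_def by (simp only: mult.left_commute)
qed

text \<open>
  The set is the outside of the ball of radius \<open>s\<close> if \<open>s > sqrt d\<close>, and the ball itself if
  \<open>s < sqrt d\<close>; describing it by the sign of a product treats the two tails at once.
\<close>
lemma gaussian_beyond_radius:
  fixes M :: "'a measure" and X :: "'a \<Rightarrow> real ^ 'n" and s :: real
  assumes "prob_space M"
    and X: "distributed M lborel X (\<lambda>x. ennreal (spherical_gaussian_density x))"
    and "0 \<le> s"
  shows "measure M {\<omega> \<in> space M. 0 \<le> ((norm (X \<omega>))\<^sup>2 - s\<^sup>2) * (s\<^sup>2 - real CARD('n))}
    \<le> exp (- (s - sqrt (real CARD('n)))\<^sup>2 / 2)"
proof -
  interpret prob_space M by fact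
  define d where "d = real CARD('n)"
  define A where "A = {x :: real ^ 'n. 0 \<le> ((norm x)\<^sup>2 - s\<^sup>2) * (s\<^sup>2 - d)}"
  let ?\<phi> = "\<lambda>x :: real ^ 'n. ennreal (spherical_gaussian_density x)"
  have d: "d > 0" by (simp add: d_def)
  have [measurable]: "A \<in> sets borel" unfolding A_def by measurable
  have event: "emeasure M (X -` B \<inter> space M) = (\<integral>\<^sup>+x. ?\<phi> x * indicator B x \<partial>lborel)"
    if "B \<in> sets borel" for B
    using distributed_emeasure[OF X, of B] that by simp
  have mass: "(\<integral>\<^sup>+x. ?\<phi> x \<partial>lborel) = 1"
    using event[of UNIV] emeasure_space_1 by simp
  have "emeasure M (X -` A \<inter> space M) \<le> ennreal (exp (- (s - sqrt d)\<^sup>2 / 2))"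
  proof (cases "s = 0")
    case True
    \<comment> \<open>This is the lower tail at \<open>\<epsilon> = sqrt d\<close>: the dilation degenerates, but \<open>A\<close> is null.\<close>
    then have "A \<subseteq> {0}" using d by (auto simp: A_def mult_le_0_iff zero_le_mult_iff)
    then have "A \<in> null_sets lborel"
      by (meson countable_imp_null_set_lborel countable_subset countable_finite finite.intros)
    then have "AE x in lborel. ?\<phi> x * indicator A x = 0"
      by (rule AE_not_in[THEN AE_mp]) auto
    then have "(\<integral>\<^sup>+x. ?\<phi> x * indicator A x \<partial>lborel) = (\<integral>\<^sup>+x. 0 \<partial>(lborel :: (real ^ 'n) measure))"
      by (rule nn_integral_cong_AE)
    then show ?thesis
      by (simp add: event)
  next
    case False
    define \<sigma> where "\<sigma> = s / sqrt d"
    define K where "K = exp (- (s\<^sup>2 - d) / 2)"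
    have s: "s > 0" using False \<open>0 \<le> s\<close> by simp
    then have \<sigma>: "\<sigma> > 0" using d by (simp add: \<sigma>_def)
    have "?\<phi> x * indicator A x \<le> ennreal K * ?\<phi> (x /\<^sub>R \<sigma>)" for x
      using spherical_gaussian_density_le_dilated[OF s, of x]
      by (auto simp: A_def K_def \<sigma>_def d_def ennreal_mult'[symmetric] ennreal_leI
          split: split_indicator)
    then have "emeasure M (X -` A \<inter> space M) \<le> (\<integral>\<^sup>+x. ennreal K * ?\<phi> (x /\<^sub>R \<sigma>) \<partial>lborel)"
      by (subst event) (auto intro: nn_integral_mono)
    also have "\<dots> = ennreal K * (\<integral>\<^sup>+x. ?\<phi> (x /\<^sub>R \<sigma>) \<partial>lborel)"
      by (rule nn_integral_cmult) measurable
    also have "\<dots> = ennreal (K * \<sigma> ^ CARD('n))"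
      using nn_integral_lborel_dilate[of ?\<phi> \<sigma>] \<sigma> mass
      by (simp add: K_def ennreal_mult'[symmetric])
    also have "\<dots> \<le> ennreal (exp (- (s - sqrt d)\<^sup>2 / 2))"
    proof (rule ennreal_leI)
      have "\<sigma> ^ CARD('n) \<le> exp (\<sigma> - 1) ^ CARD('n)"
        using \<sigma> exp_ge_add_one_self[of "\<sigma> - 1"] by (intro power_mono) auto
      also have "\<dots> = exp (sqrt d * s - d)"
      proof -
        have "d * \<sigma> = sqrt d * s"
          using d by (simp add: \<sigma>_def field_simps)
        then show ?thesis
          by (simp add: exp_of_nat_mult[symmetric] d_def[symmetric] right_diff_distrib)
      qed
      finally have "K * \<sigma> ^ CARD('n) \<le> K * exp (sqrt d * s - d)"
        by (simp add: K_def)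
      also have "\<dots> = exp (- (s - sqrt d)\<^sup>2 / 2)"
        using d by (simp add: K_def exp_add[symmetric] power2_diff field_simps)
      finally show "K * \<sigma> ^ CARD('n) \<le> exp (- (s - sqrt d)\<^sup>2 / 2)" .
    qed
    finally show ?thesis .
  qed
  moreover have "X -` A \<inter> space M
      = {\<omega> \<in> space M. 0 \<le> ((norm (X \<omega>))\<^sup>2 - s\<^sup>2) * (s\<^sup>2 - real CARD('n))}"
    by (auto simp: A_def d_def)
  ultimately show ?thesis
    by (simp add: emeasure_eq_measure d_def)
qed

theorem theorem4p7:
  fixes M :: "'a measure" and X :: "'a \<Rightarrow> real ^ 'n" and \<epsilon> :: real
  assumes "prob_space M"
    and "distributed M lborel X (\<lambda>x. ennreal (spherical_gaussian_density x))"
    and "0 \<le> \<epsilon>" and "\<epsilon> \<le> sqrt (real CARD('n))"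
  shows "measure M {\<omega> \<in> space M. \<bar>norm (X \<omega>) - sqrt (real CARD('n))\<bar> \<ge> \<epsilon>}
           \<le> 2 * exp (- (1 / 16) * \<epsilon>\<^sup>2)"
proof -
  interpret prob_space M by fact
  define r where "r = sqrt (real CARD('n))"
  define T where "T s = {\<omega> \<in> space M. 0 \<le> ((norm (X \<omega>))\<^sup>2 - s\<^sup>2) * (s\<^sup>2 - r\<^sup>2)}" for s
  have r: "r\<^sup>2 = real CARD('n)" "0 \<le> r" by (simp_all add: r_def)
  have [measurable]: "X \<in> borel_measurable M"
    using assms(2) by (simp add: distributed_def)
  have [measurable]: "T s \<in> sets M" for s unfolding T_def by measurable
  have tail: "measure M (T s) \<le> exp (- (s - r)\<^sup>2 / 2)" if "0 \<le> s" for s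
    using gaussian_beyond_radius[OF assms(1,2) that] by (simp add: T_def r(1) r_def)
  have "{\<omega> \<in> space M. \<bar>norm (X \<omega>) - r\<bar> \<ge> \<epsilon>} \<subseteq> T (r + \<epsilon>) \<union> T (r - \<epsilon>)"
  proof
    fix \<omega> assume "\<omega> \<in> {\<omega> \<in> space M. \<bar>norm (X \<omega>) - r\<bar> \<ge> \<epsilon>}"
    then have \<omega>: "\<omega> \<in> space M" and "r + \<epsilon> \<le> norm (X \<omega>) \<or> norm (X \<omega>) \<le> r - \<epsilon>" by auto
    then consider "r + \<epsilon> \<le> norm (X \<omega>)" | "norm (X \<omega>) \<le> r - \<epsilon>" by auto
    then show "\<omega> \<in> T (r + \<epsilon>) \<union> T (r - \<epsilon>)"
    proof cases
      case 1
      then have "(r + \<epsilon>)\<^sup>2 \<le> (norm (X \<omega>))\<^sup>2" "r\<^sup>2 \<le> (r + \<epsilon>)\<^sup>2"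
        using r(2) assms(3) by (auto intro!: power_mono)
      then show ?thesis using \<omega> by (simp add: T_def)
    next
      case 2
      then have "(norm (X \<omega>))\<^sup>2 \<le> (r - \<epsilon>)\<^sup>2" "(r - \<epsilon>)\<^sup>2 \<le> r\<^sup>2"
        using assms(3) assms(4)[folded r_def] by (auto intro!: power_mono)
      then show ?thesis using \<omega> by (simp add: T_def mult_nonpos_nonpos)
    qed
  qed
  then have "measure M {\<omega> \<in> space M. \<bar>norm (X \<omega>) - r\<bar> \<ge> \<epsilon>} \<le> measure M (T (r + \<epsilon>) \<union> T (r - \<epsilon>))"
    by (intro finite_measure_mono) auto
  also have "\<dots> \<le> measure M (T (r + \<epsilon>)) + measure M (T (r - \<epsilon>))"
    by (intro measure_Un_le) auto
  also have "\<dots> \<le> 2 * exp (- \<epsilon>\<^sup>2 / 2)"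
    using tail[of "r + \<epsilon>"] tail[of "r - \<epsilon>"] assms(3,4) r(2) by (simp add: r_def)
  also have "\<dots> \<le> 2 * exp (- (1 / 16) * \<epsilon>\<^sup>2)" by simp
  finally show ?thesis by (simp add: r_def)
qed

end
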